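(* The dynamic $s$-$t$-reachability query cannot be maintained in $\mathrm{DynProp}$ with an invariant initialization mapping. This holds even when restricted to dynamic instances in which the initial graph and all graphs arising from the modifications are 1-layered $s$-$t$-graphs.
   Context: An $s$-$t$-graph is a structure over the schema with one binary relation symbol $E$ and two constants $s,t$; the $s$-$t$-reachability query is true iff there is a directed path from $s$ to $t$. A 1-layered $s$-$t$-graph is one where $V\setminus\{s,t\}=A_1$ and every edge goes from $s$ to $A_1$ or from $A_1$ to $t$. Dynamic setting: a dynamic schema is $(\tau_{in},\tau_{aux})$ of relational schemas (input, auxiliary), no built-in relations; concrete modifications insert or delete a single tuple of an input relation (constants are never modified). An update program has, for every $R\in\tau_{aux}$ and every abstract modification $\delta\in\{\mathrm{ins}_S,\mathrm{del}_S\}$, $S\in\tau_{in}$, a quantifier-free formula $\varphi^R_\delta(\vec x;\vec y)$ over $\tau_{in}\cup\tau_{aux}$; after modification $\delta(\vec a)$ the input is modified and each $R\in\tau_{aux}$ becomes $\{\vec b:\text{old state}\models\varphi^R_\delta(\vec a;\vec b)\}$. A dynamic program $(P,\mathrm{Init},Q)$ additionally has an initialization mapping $\mathrm{Init}$ from input databases to auxiliary databases over the same domain and a query symbol $Q\in\tau_{aux}$; it maintains a query if for every input database $\mathcal D$ (arbitrary, not necessarily empty) and every finite modification sequence $\alpha$, $Q$ in the state obtained by applying $\alpha$ to $(\mathcal D,\mathrm{Init}(\mathcal D))$ equals the query answer on $\alpha(\mathcal D)$. The initialization mapping is invariant if $\pi(\mathrm{Init}(\mathcal D))=\mathrm{Init}(\pi(\mathcal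 D))$ for every input database $\mathcal D$ and every permutation $\pi$ of its domain. *)

theory Defs
  imports "HOL-Library.Infinite_Typeclass" "HOL-Combinatorics.Permutations"
begin

text \<open>A relational schema. Constant symbols are kept apart: all elements of a type \<open>'c\<close> serve as
  the constants of the input schema, and the auxiliary schema has none.\<close>

record 'r schema =
  symbols :: "'r set"
  arity :: "'r \<Rightarrow> nat"

definition tuples :: "nat \<Rightarrow> 'a set \<Rightarrow> 'a list set" where
  "tuples k A = {xs. length xs = k \<and> set xs \<subseteq> A}"

text \<open>Relations outside the schema are required to be empty, so that equality of databases is
  equality on the symbols of the schema.\<close>

definition relations_over :: "'r schema \<Rightarrow> 'a set \<Rightarrow> ('r \<Rightarrow> 'a list set) \<Rightarrow> bool" where
  "relations_over \<tau> A I \<longleftrightarrow>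
     (\<forall>R\<in>symbols \<tau>. I R \<subseteq> tuples (arity \<tau> R) A) \<and> (\<forall>R. R \<notin> symbols \<tau> \<longrightarrow> I R = {})"

record ('r, 'c, 'a) database =
  universe :: "'a set"
  rel :: "'r \<Rightarrow> 'a list set"
  const :: "'c \<Rightarrow> 'a"

definition is_database :: "'r schema \<Rightarrow> ('r, 'c, 'a) database \<Rightarrow> bool" where
  "is_database \<tau> D \<longleftrightarrow>
     finite (universe D) \<and> relations_over \<tau> (universe D) (rel D) \<and> range (const D) \<subseteq> universe D"

definition map_relations :: "('a \<Rightarrow> 'a) \<Rightarrow> ('r \<Rightarrow> 'a list set) \<Rightarrow> ('r \<Rightarrow> 'a list set)" where
  "map_relations \<pi> I = (\<lambda>R. map \<pi> ` I R)"

definition map_database :: "('a \<Rightarrow> 'a) \<Rightarrow> ('r, 'c, 'a) database \<Rightarrow> ('r, 'c, 'a) database" where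
  "map_database \<pi> D =
     \<lparr>universe = \<pi> ` universe D, rel = map_relations \<pi> (rel D), const = \<pi> \<circ> const D\<rparr>"


subsection \<open>Quantifier-free formulas\<close>

datatype ('c, 'v) qf_term = Var 'v | Const 'c

datatype ('r, 'c, 'v) qf_formula =
    QTrue
  | QEq "('c, 'v) qf_term" "('c, 'v) qf_term"
  | QRel 'r "('c, 'v) qf_term list"
  | QNot "('r, 'c, 'v) qf_formula"
  | QAnd "('r, 'c, 'v) qf_formula" "('r, 'c, 'v) qf_formula"
  | QOr "('r, 'c, 'v) qf_formula" "('r, 'c, 'v) qf_formula"

fun term_over :: "'v set \<Rightarrow> ('c, 'v) qf_term \<Rightarrow> bool" where
  "term_over V (Var v) \<longleftrightarrow> v \<in> V"
| "term_over V (Const c) \<longleftrightarrow> True"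

fun formula_over :: "'r schema \<Rightarrow> 'v set \<Rightarrow> ('r, 'c, 'v) qf_formula \<Rightarrow> bool" where
  "formula_over \<tau> V QTrue \<longleftrightarrow> True"
| "formula_over \<tau> V (QEq t u) \<longleftrightarrow> term_over V t \<and> term_over V u"
| "formula_over \<tau> V (QRel R ts) \<longleftrightarrow>
     R \<in> symbols \<tau> \<and> length ts = arity \<tau> R \<and> (\<forall>t\<in>set ts. term_over V t)"
| "formula_over \<tau> V (QNot \<phi>) \<longleftrightarrow> formula_over \<tau> V \<phi>"
| "formula_over \<tau> V (QAnd \<phi> \<psi>) \<longleftrightarrow> formula_over \<tau> V \<phi> \<and> formula_over \<tau> V \<psi>"
| "formula_over \<tau> V (QOr \<phi> \<psi>) \<longleftrightarrow> formula_over \<tau> V \<phi> \<and> formula_over \<tau> V \<psi>"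

fun term_val :: "('c \<Rightarrow> 'a) \<Rightarrow> ('v \<Rightarrow> 'a) \<Rightarrow> ('c, 'v) qf_term \<Rightarrow> 'a" where
  "term_val c e (Var v) = e v"
| "term_val c e (Const k) = c k"

fun holds :: "('r \<Rightarrow> 'a list set) \<Rightarrow> ('c \<Rightarrow> 'a) \<Rightarrow> ('v \<Rightarrow> 'a) \<Rightarrow> ('r, 'c, 'v) qf_formula \<Rightarrow> bool" where
  "holds I c e QTrue \<longleftrightarrow> True"
| "holds I c e (QEq t u) \<longleftrightarrow> term_val c e t = term_val c e u"
| "holds I c e (QRel R ts) \<longleftrightarrow> map (term_val c e) ts \<in> I R"
| "holds I c e (QNot \<phi>) \<longleftrightarrow> \<not> holds I c e \<phi>"
| "holds I c e (QAnd \<phi> \<psi>) \<longleftrightarrow> holds I c e \<phi> \<and> holds I c e \<psi>"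
| "holds I c e (QOr \<phi> \<psi>) \<longleftrightarrow> holds I c e \<phi> \<or> holds I c e \<psi>"


subsection \<open>Dynamic programs\<close>

definition joint_schema :: "'i schema \<Rightarrow> 'r schema \<Rightarrow> ('i + 'r) schema" where
  "joint_schema \<tau>\<^sub>1 \<tau>\<^sub>2 =
     \<lparr>symbols = symbols \<tau>\<^sub>1 <+> symbols \<tau>\<^sub>2, arity = case_sum (arity \<tau>\<^sub>1) (arity \<tau>\<^sub>2)\<rparr>"

datatype 'i abs_modification = Ins 'i | Del 'i

fun mod_symbol :: "'i abs_modification \<Rightarrow> 'i" where
  "mod_symbol (Ins S) = S"
| "mod_symbol (Del S) = S"

type_synonym ('i, 'a) modification = "'i abs_modification \<times> 'a list"

definition is_modification :: "'i schema \<Rightarrow> 'a set \<Rightarrow> ('i, 'a) modification \<Rightarrow> bool" where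
  "is_modification \<tau> A m \<longleftrightarrow>
     mod_symbol (fst m) \<in> symbols \<tau> \<and> snd m \<in> tuples (arity \<tau> (mod_symbol (fst m))) A"

fun modify :: "('i, 'a) modification \<Rightarrow> ('i, 'c, 'a) database \<Rightarrow> ('i, 'c, 'a) database" where
  "modify (Ins S, a) D = D\<lparr>rel := (rel D)(S := insert a (rel D S))\<rparr>"
| "modify (Del S, a) D = D\<lparr>rel := (rel D)(S := rel D S - {a})\<rparr>"

text \<open>The variables of an update formula \<open>\<phi>(x\<^sub>0,x\<^sub>1,\<dots>; y\<^sub>0,y\<^sub>1,\<dots>)\<close>: \<open>X i\<close> stands for the \<open>i\<close>-th component
  of the modified tuple, \<open>Y j\<close> for the \<open>j\<close>-th component of the tuple tested for membership.\<close>

datatype upd_var = X nat | Y nat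

fun upd_env :: "'a list \<Rightarrow> 'a list \<Rightarrow> upd_var \<Rightarrow> 'a" where
  "upd_env a b (X i) = a ! i"
| "upd_env a b (Y j) = b ! j"

record ('i, 'c, 'r, 'a) dyn_program =
  aux_schema :: "'r schema"
  update_formula :: "'i abs_modification \<Rightarrow> 'r \<Rightarrow> ('i + 'r, 'c, upd_var) qf_formula"
  init :: "('i, 'c, 'a) database \<Rightarrow> 'r \<Rightarrow> 'a list set"
  query_symbol :: "'r"

text \<open>Finiteness of the auxiliary schema is essential: infinitely many nullary auxiliary relations
  could act as an unbounded counter.\<close>

definition is_dynprop_program :: "'i schema \<Rightarrow> ('i, 'c, 'r, 'a) dyn_program \<Rightarrow> bool" where
  "is_dynprop_program \<tau> P \<longleftrightarrow>
     finite (symbols (aux_schema P)) \<and>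
     query_symbol P \<in> symbols (aux_schema P) \<and>
     (\<forall>D. is_database \<tau> D \<longrightarrow> relations_over (aux_schema P) (universe D) (init P D)) \<and>
     (\<forall>\<delta>. \<forall>R\<in>symbols (aux_schema P). mod_symbol \<delta> \<in> symbols \<tau> \<longrightarrow>
        formula_over (joint_schema \<tau> (aux_schema P))
          (X ` {..<arity \<tau> (mod_symbol \<delta>)} \<union> Y ` {..<arity (aux_schema P) R})
          (update_formula P \<delta> R))"

definition invariant_init :: "'i schema \<Rightarrow> ('i, 'c, 'r, 'a) dyn_program \<Rightarrow> bool" where
  "invariant_init \<tau> P \<longleftrightarrow>
     (\<forall>D \<pi>. is_database \<tau> D \<and> \<pi> permutes universe D \<longrightarrow>
        map_relations \<pi> (init P D) = init P (map_database \<pi> D))"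

type_synonym ('i, 'c, 'r, 'a) state = "('i, 'c, 'a) database \<times> ('r \<Rightarrow> 'a list set)"

fun update ::
  "('i, 'c, 'r, 'a) dyn_program \<Rightarrow> ('i, 'a) modification \<Rightarrow> ('i, 'c, 'r, 'a) state \<Rightarrow> ('i, 'c, 'r, 'a) state"
where
  "update P (\<delta>, a) (D, A) =
     (modify (\<delta>, a) D,
      \<lambda>R. if R \<in> symbols (aux_schema P)
          then {b \<in> tuples (arity (aux_schema P) R) (universe D).
                  holds (case_sum (rel D) A) (const D) (upd_env a b) (update_formula P \<delta> R)}
          else {})"

text \<open>Maintenance of a query \<open>q\<close> on the dynamic instances in which the initial database and all
  databases arising from the modifications belong to the class \<open>C\<close>.\<close>

definition maintains_on ::
  "'i schema \<Rightarrow> (('i, 'c, 'a) database \<Rightarrow> bool) \<Rightarrow> ('i, 'c, 'r, 'a) dyn_program \<Rightarrow>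
   (('i, 'c, 'a) database \<Rightarrow> 'a list set) \<Rightarrow> bool"
where
  "maintains_on \<tau> C P q \<longleftrightarrow>
     (\<forall>D ms. is_database \<tau> D \<and> (\<forall>m\<in>set ms. is_modification \<tau> (universe D) m) \<and>
        (\<forall>k\<le>length ms. C (fold modify (take k ms) D)) \<longrightarrow>
        snd (fold (update P) ms (D, init P D)) (query_symbol P) = q (fold modify ms D))"

definition maintains ::
  "'i schema \<Rightarrow> ('i, 'c, 'r, 'a) dyn_program \<Rightarrow> (('i, 'c, 'a) database \<Rightarrow> 'a list set) \<Rightarrow> bool"
where
  "maintains \<tau> P q \<longleftrightarrow> maintains_on \<tau> (\<lambda>_. True) P q"


subsection \<open>Reachability in \<open>s\<close>-\<open>t\<close>-graphs\<close>

datatype st_rel = E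
datatype st_const = S | T

definition st_schema :: "st_rel schema" where
  "st_schema = \<lparr>symbols = {E}, arity = (\<lambda>_. 2)\<rparr>"

type_synonym 'a st_graph = "(st_rel, st_const, 'a) database"

definition edges :: "'a st_graph \<Rightarrow> ('a \<times> 'a) set" where
  "edges G = {(u, v). [u, v] \<in> rel G E}"

text \<open>A Boolean query is a 0-ary one: true is \<open>{[]}\<close>, false is \<open>{}\<close>.\<close>

definition st_reach :: "'a st_graph \<Rightarrow> 'a list set" where
  "st_reach G = (if (const G S, const G T) \<in> (edges G)\<^sup>* then {[]} else {})"

definition one_layered :: "'a st_graph \<Rightarrow> bool" where
  "one_layered G \<longleftrightarrow>
     (let s = const G S; t = const G T; A\<^sub>1 = universe G - {s, t}
      in edges G \<subseteq> {s} \<times> A\<^sub>1 \<union> A\<^sub>1 \<times> {t})"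

end

theory Submission
  imports Defs
begin

text \<open>Let \<open>D\<^sub>m\<close> consist of \<open>s\<close>, \<open>t\<close> and \<open>m\<close> inner nodes, each joined to both \<open>s\<close> and \<open>t\<close>. An invariant
  initialization cannot distinguish the inner nodes, so the auxiliary data on \<open>D\<^sub>m\<close> is determined by
  its restriction to \<open>s\<close>, \<open>t\<close> and \<open>k\<close> inner nodes, where \<open>k\<close> bounds the arities. By the pigeonhole
  principle there are \<open>m < m'\<close> for which this restriction is the same, so that \<open>D\<^sub>m\<close> is, together with
  its auxiliary data, a substructure of \<open>D\<^sub>m\<^sub>'\<close>. Quantifier-free updates preserve substructures. Hence
  deleting the \<open>m\<close> edges from \<open>s\<close> to the inner nodes of \<open>D\<^sub>m\<close> yields the same answer on both graphs,
  although only in \<open>D\<^sub>m\<^sub>'\<close> the node \<open>t\<close> is still reachable.\<close>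

lemma finite_tuples: "finite A \<Longrightarrow> finite (tuples k A)"
  using finite_lists_length_eq[of A k] by (simp add: tuples_def conj_commute)

text \<open>Shrink \<open>F\<close> to the size of \<open>C\<close>. The complements in the finite
  set \<open>B\<close> then have equal size too, so a bijection between the small sets extends to
  all of \<open>B\<close>.\<close>

lemma permutes_into:
  assumes "finite B" "C \<subseteq> B" "F \<subseteq> B" "card C \<le> card F"
  obtains \<pi> where "\<pi> permutes B" "\<pi> ` C \<subseteq> F"
proof -
  obtain F' where F': "F' \<subseteq> F" "card F' = card C"
    using assms(4) by (meson obtain_subset_with_card_n)
  have fin: "finite C" "finite F'" "F' \<subseteq> B"
    using assms F' by (auto intro: finite_subset)
  obtain f where f: "bij_betw f C F'"
    using finite_same_card_bij[of C F'] F' fin by auto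
  have "card (B - C) = card (B - F')"
    using assms fin F' by (simp add: card_Diff_subset)
  then obtain g where g: "bij_betw g (B - C) (B - F')"
    using finite_same_card_bij[of "B - C" "B - F'"] assms(1) by auto
  define \<pi> where "\<pi> x = (if x \<in> C then f x else if x \<in> B then g x else x)" for x
  have "bij_betw \<pi> C F'"
    using f by (simp add: \<pi>_def cong: bij_betw_cong)
  moreover have "bij_betw \<pi> (B - C) (B - F')"
    using g by (subst bij_betw_cong[of _ _ g]) (auto simp: \<pi>_def)
  ultimately have "bij_betw \<pi> (C \<union> (B - C)) (F' \<union> (B - F'))"
    by (rule bij_betw_combine) auto
  then have "bij_betw \<pi> B B"
    using assms(2) fin(3) by (simp add: Un_absorb1)
  then have "\<pi> permutes B"
    using assms(2) by (intro bij_imp_permutes) (auto simp: \<pi>_def)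
  moreover have "\<pi> ` C \<subseteq> F"
    using \<open>bij_betw \<pi> C F'\<close> F' by (auto simp: bij_betw_def)
  ultimately show thesis by (rule that)
qed


subsection \<open>Quantifier-free updates preserve substructures\<close>

lemma term_val_in:
  "term_over V t \<Longrightarrow> range c \<subseteq> U \<Longrightarrow> e ` V \<subseteq> U \<Longrightarrow> term_val c e t \<in> U"
  by (cases t) auto

text \<open>There are no quantifiers and no function symbols besides constants, so evaluation only
  ever meets tuples over \<open>U\<close>.\<close>

lemma holds_substructure:
  assumes "range c \<subseteq> U" "e ` V \<subseteq> U"
    and "\<And>R xs. set xs \<subseteq> U \<Longrightarrow> xs \<in> I R \<longleftrightarrow> xs \<in> I' R"
    and "formula_over \<tau> V \<phi>"
  shows "holds I c e \<phi> \<longleftrightarrow> holds I' c e \<phi>"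
  using assms(4)
proof (induction \<phi>)
  case (QRel R ts)
  then have "set (map (term_val c e) ts) \<subseteq> U"
    using term_val_in[OF _ assms(1,2)] by auto
  then show ?case using assms(3) by simp
qed auto

lemma modify_simps [simp]:
  "universe (modify m D) = universe D" "const (modify m D) = const D"
  by (induction m D rule: modify.induct) simp_all

text \<open>Both states induce the same substructure on \<open>U\<close>. The constants must lie in
  \<open>U\<close>, since update formulas may mention them; outside \<open>U\<close> the states may
  differ freely.\<close>

definition agree_on :: "'a set \<Rightarrow> ('i, 'c, 'r, 'a) state \<Rightarrow> ('i, 'c, 'r, 'a) state \<Rightarrow> bool" where
  "agree_on U \<S> \<S>' \<longleftrightarrow>
     U \<subseteq> universe (fst \<S>) \<and> U \<subseteq> universe (fst \<S>') \<and>
     const (fst \<S>) = const (fst \<S>') \<and> range (const (fst \<S>)) \<subseteq> U \<and>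
     (\<forall>xs. set xs \<subseteq> U \<longrightarrow>
        (\<forall>R. xs \<in> rel (fst \<S>) R \<longleftrightarrow> xs \<in> rel (fst \<S>') R) \<and>
        (\<forall>R. xs \<in> snd \<S> R \<longleftrightarrow> xs \<in> snd \<S>' R))"

text \<open>As the modified tuple lies in \<open>U\<close>, deciding whether a tuple over
  \<open>U\<close> enters an auxiliary relation evaluates the same formula under an assignment into
  \<open>U\<close>.\<close>

lemma agree_on_update:
  assumes P: "is_dynprop_program \<tau> P" and m: "is_modification \<tau> U m"
    and agree: "agree_on U \<S> \<S>'"
  shows "agree_on U (update P m \<S>) (update P m \<S>')"
proof -
  obtain D A D' A' \<delta> a where [simp]: "\<S> = (D, A)" "\<S>' = (D', A')" "m = (\<delta>, a)"
    by (metis prod.exhaust)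
  note agree = agree[unfolded agree_on_def, simplified]
  have a: "mod_symbol \<delta> \<in> symbols \<tau>" "length a = arity \<tau> (mod_symbol \<delta>)" "set a \<subseteq> U"
    using m by (auto simp: is_modification_def tuples_def)
  have rels: "xs \<in> rel (modify m D) R \<longleftrightarrow> xs \<in> rel (modify m D') R" if "set xs \<subseteq> U" for xs R
    using that agree by (cases \<delta>) auto
  have formulas: "holds (case_sum (rel D) A) (const D) (upd_env a b) (update_formula P \<delta> R)
      \<longleftrightarrow> holds (case_sum (rel D') A') (const D') (upd_env a b) (update_formula P \<delta> R)"
    if "R \<in> symbols (aux_schema P)" "set b \<subseteq> U" "length b = arity (aux_schema P) R" for b R
  proof -
    let ?V = "X ` {..<arity \<tau> (mod_symbol \<delta>)} \<union> Y ` {..<arity (aux_schema P) R}"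
    have env: "upd_env a b ` ?V \<subseteq> U"
      using a that by (auto simp: image_Un image_image dest: nth_mem)
    have form: "formula_over (joint_schema \<tau> (aux_schema P)) ?V (update_formula P \<delta> R)"
      using P a that by (auto simp: is_dynprop_program_def)
    have rels: "xs \<in> case_sum (rel D) A Q \<longleftrightarrow> xs \<in> case_sum (rel D') A' Q"
      if "set xs \<subseteq> U" for xs Q
      using agree that by (cases Q) auto
    have c: "const D' = const D" "range (const D) \<subseteq> U"
      using agree by auto
    show ?thesis
      unfolding c(1) by (rule holds_substructure[OF c(2) env rels form])
  qed
  show ?thesis
    using agree rels formulas by (auto simp: agree_on_def tuples_def)
qed

lemma agree_on_fold_update:
  assumes "is_dynprop_program \<tau> P" "\<forall>m\<in>set ms. is_modification \<tau> U m" "agree_on U \<S> \<S>'"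
  shows "agree_on U (fold (update P) ms \<S>) (fold (update P) ms \<S>')"
  using assms(2,3)
proof (induction ms arbitrary: \<S> \<S>')
  case (Cons m ms)
  then have "agree_on U (update P m \<S>) (update P m \<S>')"
    using agree_on_update[OF assms(1)] by simp
  with Cons show ?case by simp
qed simp

lemma fold_modify_Del:
  "fold modify (map (Pair (Del R)) as) D = D\<lparr>rel := (rel D)(R := rel D R - set as)\<rparr>"
  by (induction as arbitrary: D) (simp_all add: Diff_insert2[symmetric])


subsection \<open>Graphs of parallel paths of length two\<close>

definition parallel_paths :: "'a \<Rightarrow> 'a \<Rightarrow> 'a set \<Rightarrow> 'a st_graph" where
  "parallel_paths s t B =
     \<lparr>universe = {s, t} \<union> B, rel = (\<lambda>_. (\<lambda>x. [s, x]) ` B \<union> (\<lambda>x. [x, t]) ` B),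
      const = case_st_const s t\<rparr>"

lemma is_database_parallel_paths: "finite B \<Longrightarrow> is_database st_schema (parallel_paths s t B)"
proof -
  have "R = E" for R :: st_rel by (cases R)
  then show "finite B \<Longrightarrow> is_database st_schema (parallel_paths s t B)"
    by (auto simp: is_database_def parallel_paths_def relations_over_def st_schema_def tuples_def
        split: st_const.splits)
qed

lemma map_parallel_paths:
  assumes "\<pi> permutes B" "s \<notin> B" "t \<notin> B"
  shows "map_database \<pi> (parallel_paths s t B) = parallel_paths s t B"
proof -
  have [simp]: "\<pi> s = s" "\<pi> t = t" "\<pi> ` B = B"
    using assms by (auto simp: permutes_not_in permutes_image)
  have "(\<lambda>x. [s, \<pi> x]) ` B = (\<lambda>x. [s, x]) ` \<pi> ` B" "(\<lambda>x. [\<pi> x, t]) ` B = (\<lambda>x. [x, t]) ` \<pi> ` B"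
    by (simp_all only: image_image)
  then show ?thesis
    by (auto simp: map_database_def parallel_paths_def map_relations_def image_Un image_image
        fun_eq_iff split: st_const.splits)
qed

text \<open>Permuting the inner nodes is an automorphism of the graph, so invariance forces the
  initial auxiliary relations to be closed under it.\<close>

lemma init_parallel_paths_invariant:
  assumes "invariant_init st_schema P" "finite B" "\<pi> permutes B" "s \<notin> B" "t \<notin> B"
  shows "map \<pi> xs \<in> init P (parallel_paths s t B) R \<longleftrightarrow> xs \<in> init P (parallel_paths s t B) R"
proof -
  let ?D = "parallel_paths s t B"
  have "\<pi> permutes universe ?D"
    using assms(3) by (rule permutes_subset) (auto simp: parallel_paths_def)
  then have "map_relations \<pi> (init P ?D) = init P ?D"
    using assms is_database_parallel_paths map_parallel_paths by (metis invariant_init_def)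
  then have "map \<pi> ` init P ?D R = init P ?D R"
    by (metis map_relations_def)
  moreover have "inj (map \<pi>)"
    using assms(3) by (simp add: permutes_inj)
  ultimately show ?thesis
    by (metis inj_image_mem_iff)
qed

lemma st_reach_parallel_paths_Del:
  assumes "s \<noteq> t" "s \<notin> B" "t \<notin> B" "C \<subseteq> B"
  defines "D \<equiv> parallel_paths s t B"
  shows "st_reach (D\<lparr>rel := (rel D)(E := rel D E - (\<lambda>x. [s, x]) ` C)\<rparr>)
    = (if C = B then {} else {[]})" (is "st_reach ?G = _")
proof -
  have edges: "edges ?G = {s} \<times> (B - C) \<union> B \<times> {t}"
    using assms by (auto simp: edges_def D_def parallel_paths_def)
  have c: "const D S = s" "const D T = t"
    by (simp_all add: D_def parallel_paths_def)
  show ?thesis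
  proof (cases "C = B")
    case True
    \<comment> \<open>A path would have to leave \<open>s\<close>, but all remaining edges start in
      \<open>B\<close>.\<close>
    have "(s, t) \<notin> (edges ?G)\<^sup>*"
      using edges True assms by (auto elim: converse_rtranclE)
    then show ?thesis using True by (simp add: st_reach_def c)
  next
    case False
    then obtain x where "x \<in> B - C" using assms by auto
    then have "(s, x) \<in> edges ?G" "(x, t) \<in> edges ?G" using edges by auto
    then have "(s, t) \<in> (edges ?G)\<^sup>*" by (meson converse_rtrancl_into_rtrancl r_into_rtrancl)
    then show ?thesis using False by (simp add: st_reach_def c)
  qed
qed

lemma one_layered_parallel_paths_Del:
  assumes "s \<notin> B" "t \<notin> B"
  defines "D \<equiv> parallel_paths s t B"
  shows "one_layered (D\<lparr>rel := (rel D)(E := rel D E - F)\<rparr>)"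
  using assms by (auto simp: one_layered_def edges_def D_def parallel_paths_def Let_def)

text \<open>Deletions keep a graph 1-layered, so the restricted maintenance hypothesis covers the
  whole sequence. All edges into \<open>t\<close> survive; reachability fails exactly when every
  inner node has lost its edge from \<open>s\<close>.\<close>

lemma maintained_after_deletions:
  assumes "maintains_on st_schema one_layered P st_reach" "finite B"
    and "s \<noteq> t" "s \<notin> B" "t \<notin> B" "set cs \<subseteq> B"
  defines "D \<equiv> parallel_paths s t B"
  shows "snd (fold (update P) (map (Pair (Del E)) (map (\<lambda>x. [s, x]) cs)) (D, init P D)) (query_symbol P)
    = (if set cs = B then {} else {[]})"
proof -
  let ?ms = "map (Pair (Del E)) (map (\<lambda>x. [s, x]) cs)"
  have "is_modification st_schema (universe D) m" if "m \<in> set ?ms" for m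
    using that assms(6)
    by (auto simp: is_modification_def st_schema_def tuples_def D_def parallel_paths_def)
  moreover have "one_layered (fold modify (take k ?ms) D)" for k
    unfolding take_map fold_modify_Del D_def
    using assms by (intro one_layered_parallel_paths_Del)
  ultimately have "snd (fold (update P) ?ms (D, init P D)) (query_symbol P)
      = st_reach (fold modify ?ms D)"
    using assms(1) is_database_parallel_paths[OF assms(2), of s t]
    by (simp add: maintains_on_def D_def del: map_map)
  also have "\<dots> = (if set cs = B then {} else {[]})"
    unfolding fold_modify_Del D_def list.set_map
    using assms by (intro st_reach_parallel_paths_Del)
  finally show ?thesis .
qed

lemma init_parallel_paths_agree:
  fixes b :: "nat \<Rightarrow> 'a" and P :: "(st_rel, st_const, 'r, 'a) dyn_program"
  assumes P: "is_dynprop_program st_schema P" and inv: "invariant_init st_schema P"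
    and b: "inj b" "s \<notin> range b" "t \<notin> range b"
  defines "D \<equiv> (\<lambda>n. parallel_paths s t (b ` {..<n}))"
  obtains m m' where "m < m'"
    "\<And>xs R. set xs \<subseteq> universe (D m) \<Longrightarrow> xs \<in> init P (D m) R \<longleftrightarrow> xs \<in> init P (D m') R"
proof -
  let ?\<tau> = "aux_schema P"
  have fin: "finite (symbols ?\<tau>)"
    using P by (simp add: is_dynprop_program_def)
  \<comment> \<open>A tuple of an auxiliary relation has at most \<open>k\<close> distinct entries,
    so it fits into \<open>k\<close> inner nodes together with \<open>s\<close> and
    \<open>t\<close>.\<close>
  then obtain k where k: "\<And>R. R \<in> symbols ?\<tau> \<Longrightarrow> arity ?\<tau> R \<le> k"
    using finite_nat_set_iff_bounded_le[of "arity ?\<tau> ` symbols ?\<tau>"] by auto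
  have univ: "universe (D n) = {s, t} \<union> b ` {..<n}" for n
    by (simp add: D_def parallel_paths_def)
  have init: "relations_over ?\<tau> (universe (D n)) (init P (D n))" for n
    using P by (simp add: is_dynprop_program_def D_def is_database_parallel_paths)
  \<comment> \<open>The fingerprint to which the pigeonhole principle applies: it takes only
    finitely many values. Indices start at \<open>k\<close> so that the first \<open>k\<close> inner
    nodes belong to each graph considered.\<close>
  define f where "f n = (SIGMA R:symbols ?\<tau>. init P (D n) R \<inter> tuples (arity ?\<tau> R) (universe (D k)))" for n
  have "f ` {k..} \<subseteq> Pow (SIGMA R:symbols ?\<tau>. tuples (arity ?\<tau> R) (universe (D k)))"
    by (auto simp: f_def)
  moreover have "finite (SIGMA R:symbols ?\<tau>. tuples (arity ?\<tau> R) (universe (D k)))"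
    using fin by (auto simp: univ intro!: finite_SigmaI finite_tuples)
  ultimately have "finite (f ` {k..})"
    by (meson finite_Pow_iff finite_subset)
  then have "\<not> inj_on f {k..}"
    using finite_imageD infinite_Ici by blast
  then obtain m m' where m: "k \<le> m" "m < m'" "f m = f m'"
    unfolding inj_on_def by (metis atLeast_iff linorder_neqE_nat)
  have "xs \<in> init P (D m) R \<longleftrightarrow> xs \<in> init P (D m') R" if xs: "set xs \<subseteq> universe (D m)" for xs R
  proof (cases "R \<in> symbols ?\<tau> \<and> length xs = arity ?\<tau> R")
    \<comment> \<open>Both sides are false: initial relations respect the auxiliary schema.\<close>
    case False
    then show ?thesis using init by (fastforce simp: relations_over_def tuples_def)
  next
    case True
    let ?B = "\<lambda>n. b ` {..<n}"
    have "card (set xs \<inter> ?B m) \<le> length xs"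
      by (meson card_length card_mono finite_set inf_le1 le_trans)
    also have "\<dots> \<le> card (?B k)"
      using True k b(1) by (simp add: card_image inj_on_subset)
    finally obtain \<pi> where \<pi>: "\<pi> permutes ?B m" "\<pi> ` (set xs \<inter> ?B m) \<subseteq> ?B k"
      using permutes_into[of "?B m" "set xs \<inter> ?B m" "?B k"] m(1)
      by (metis finite_imageI finite_lessThan image_mono inf_le2 lessThan_subset_iff)
    \<comment> \<open>The same \<open>\<pi>\<close> serves the larger graph, because it fixes the
      additional nodes.\<close>
    have \<pi>': "\<pi> permutes ?B m'"
      using \<pi>(1) by (rule permutes_subset) (use m in auto)
    have fixed: "\<pi> s = s" "\<pi> t = t"
      using \<pi>(1) b by (auto intro: permutes_not_in)
    have "\<pi> x \<in> universe (D k)" if "x \<in> set xs" for x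
    proof (cases "x \<in> ?B m")
      case True
      then show ?thesis using \<pi>(2) that unfolding univ by (intro UnI2) (rule subsetD, auto)
    next
      case False
      then show ?thesis using xs that fixed unfolding univ by auto
    qed
    then have "set (map \<pi> xs) \<subseteq> universe (D k)" by auto
    \<comment> \<open>Once moved into \<open>D k\<close>, the tuple is visible to the
      fingerprint.\<close>
    then have *: "map \<pi> xs \<in> init P (D n) R \<longleftrightarrow> (R, map \<pi> xs) \<in> f n" for n
      using True by (auto simp: f_def tuples_def)
    have "xs \<in> init P (D n) R \<longleftrightarrow> map \<pi> xs \<in> init P (D n) R" if "\<pi> permutes ?B n" for n
      unfolding D_def using init_parallel_paths_invariant[OF inv _ that] b by blast
    then show ?thesis using * m(3) \<pi>(1) \<pi>' by simp
  qed
  with m(2) show thesis by (rule that)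
qed

lemma st_reach_one_layered_not_maintainable:
  fixes P :: "(st_rel, st_const, 'r, 'a::infinite) dyn_program"
  assumes P: "is_dynprop_program st_schema P" and inv: "invariant_init st_schema P"
  shows "\<not> maintains_on st_schema one_layered P st_reach"
proof
  assume M: "maintains_on st_schema one_layered P st_reach"
  obtain v :: "nat \<Rightarrow> 'a" where v: "inj v"
    using infinite_countable_subset[OF infinite_UNIV] by auto
  \<comment> \<open>The shift by two reserves the first two values of \<open>v\<close> for
    \<open>s\<close> and \<open>t\<close>.\<close>
  define s t b where "s = v 0" and "t = v 1" and "b = (\<lambda>i. v (i + 2))"
  have st: "s \<noteq> t" and b: "inj b" "s \<notin> range b" "t \<notin> range b"
    using v by (auto simp: s_def t_def b_def inj_def)
  define D where "D n = parallel_paths s t (b ` {..<n})" for n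
  obtain m m' where m: "m < m'"
    and init: "\<And>xs R. set xs \<subseteq> universe (D m) \<Longrightarrow> xs \<in> init P (D m) R \<longleftrightarrow> xs \<in> init P (D m') R"
    using init_parallel_paths_agree[OF P inv b] unfolding D_def by blast
  define cs where "cs = map b [0..<m]"
  define ms where "ms = map (Pair (Del E)) (map (\<lambda>x. [s, x]) cs)"
  have cs: "set cs = b ` {..<m}"
    by (auto simp: cs_def)
  \<comment> \<open>In the larger graph, \<open>b m\<close> keeps its edge from
    \<open>s\<close>.\<close>
  have "b m \<in> b ` {..<m'} - set cs"
    using m b(1) by (auto simp: cs inj_eq)
  then have proper: "set cs \<noteq> b ` {..<m'}" "set cs \<subseteq> b ` {..<m'}"
    using m by (auto simp: cs)
  have "agree_on (universe (D m)) (D m, init P (D m)) (D m', init P (D m'))"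
    using init m b st
    by (auto simp: agree_on_def D_def parallel_paths_def split: st_const.splits)
  moreover have "\<forall>x\<in>set ms. is_modification st_schema (universe (D m)) x"
    by (auto simp: ms_def cs is_modification_def st_schema_def tuples_def D_def parallel_paths_def)
  ultimately have "agree_on (universe (D m))
      (fold (update P) ms (D m, init P (D m))) (fold (update P) ms (D m', init P (D m')))"
    using agree_on_fold_update[OF P] by blast
  \<comment> \<open>The empty tuple lies over every set, so agreement fixes the Boolean
    answer.\<close>
  then have "[] \<in> snd (fold (update P) ms (D m, init P (D m))) (query_symbol P)
      \<longleftrightarrow> [] \<in> snd (fold (update P) ms (D m', init P (D m'))) (query_symbol P)"
    unfolding agree_on_def by (metis empty_set empty_subsetI)
  moreover have "snd (fold (update P) ms (D m, init P (D m))) (query_symbol P) = {}"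
    using maintained_after_deletions[OF M, of "b ` {..<m}" s t cs] st b cs
    by (auto simp: ms_def D_def)
  moreover have "snd (fold (update P) ms (D m', init P (D m'))) (query_symbol P) = {[]}"
    using maintained_after_deletions[OF M, of "b ` {..<m'}" s t cs] st b proper
    by (auto simp: ms_def D_def)
  ultimately show False by simp
qed

theorem theorem4p12:
  "(\<nexists>P :: (st_rel, st_const, 'r, 'a::infinite) dyn_program.
      is_dynprop_program st_schema P \<and> invariant_init st_schema P \<and>
      maintains st_schema P st_reach) \<and>
   (\<nexists>P :: (st_rel, st_const, 'r, 'a::infinite) dyn_program.
      is_dynprop_program st_schema P \<and> invariant_init st_schema P \<and>
      maintains_on st_schema one_layered P st_reach)"
proof -
  \<comment> \<open>Restricting the instances weakens the maintenance requirement, so the 1-layered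
    case yields both claims.\<close>
  have "maintains_on st_schema one_layered P st_reach" if "maintains st_schema P st_reach"
    for P :: "(st_rel, st_const, 'r, 'a) dyn_program"
    using that by (simp add: maintains_def maintains_on_def)
  then show ?thesis
    using st_reach_one_layered_not_maintainable by blast
qed

end
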